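(* Let $n_1,\ldots,n_m$ be positive integers and set $n_{m+1}=0$. For every integer $j$ with $0\leq j\leq m-1$, $$(q)_{n_1}\prod_{i=1}^m\frac{(q)_{n_i+n_{i+1}}}{(q)_{2n_i}}\sum_{k=-n_1}^{n_1}(-1)^kq^{jk^2+\binom{k}{2}}\prod_{i=1}^m{2n_i\brack n_i+k}$$ is a polynomial in $q$ with nonnegative integer coefficients.
   Context: For an integer $n\ge 0$, $(q)_n=(1-q)(1-q^2)\cdots(1-q^n)$ (with $(q)_0=1$). The $q$-binomial coefficient is ${n\brack k}=\frac{(q)_n}{(q)_k(q)_{n-k}}$ for $0\le k\le n$, and $0$ otherwise. *)

theory Defs
  imports "HOL-Computational_Algebra.Polynomial_Factorial"
begin

definition q_fact :: "'a::comm_ring_1 \<Rightarrow> nat \<Rightarrow> 'a" where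
  "q_fact q n = (\<Prod>i=1..n. 1 - q ^ i)"

text \<open>
  The quotient is meant in a field in which \<open>q\<close> is not a root of unity. The lower argument
  is an integer, since it takes the values \<open>n + k\<close> with \<open>k\<close> negative.
\<close>

definition q_binomial :: "'a::field \<Rightarrow> nat \<Rightarrow> int \<Rightarrow> 'a" where
  "q_binomial q n k =
     (if 0 \<le> k \<and> k \<le> int n
      then q_fact q n / (q_fact q (nat k) * q_fact q (n - nat k)) else 0)"

text \<open>The indeterminate \<open>q\<close>, as an element of the fraction field of \<open>\<int>[q]\<close>, that is, of \<open>\<rat>(q)\<close>.\<close>

definition qvar :: "int poly fract" where
  "qvar = to_fract [:0, 1:]"

end

theory Submission
  imports Defs
begin

text \<open>
  Up to factors independent of \<open>k\<close>, the \<open>k\<close>-th summand is a product of kernels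
  \<open>A\<^sub>a(k) = 1 / ((q)\<^bsub>a-k\<^esub> (q)\<^bsub>a+k\<^esub>)\<close>. The two forms of the \<open>q\<close>-Vandermonde identity expand
  \<open>(q)\<^bsub>a+b\<^esub> A\<^sub>a(k) A\<^sub>b(k)\<close> into a sum over \<open>s\<close> of multiples of \<open>A\<^sub>s(k)\<close>, as in Bailey's lemma, with
  weight \<open>q\<^bsup>s\<^sup>2-k\<^sup>2\<^esup>\<close> or \<open>q\<^bsup>(a-s)(b-s)\<^esup>\<close>. Applied to \<open>n\<^sub>1, n\<^sub>2\<close>, the first form lowers \<open>(m, j)\<close> to
  \<open>(m - 1, j - 1)\<close> and the second one lowers \<open>m\<close> alone (used for \<open>j = 0\<close>); in both cases the sums of
  length \<open>m - 1\<close> get products of \<open>q\<close>-binomials and powers of \<open>q\<close> as coefficients. The recursion ends at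
  \<open>(1, 0)\<close>, where the sum telescopes to 0 or 1.
\<close>

section \<open>Reciprocal q-factorials and q-Pascal rules\<close>

locale generic_q =
  fixes q :: "'a::field"
  assumes q_nonzero: "q \<noteq> 0"
    and q_power_neq_1: "i > 0 \<Longrightarrow> q ^ i \<noteq> 1"
begin

lemma q_fact_nonzero: "q_fact q n \<noteq> 0"
  using q_power_neq_1 by (fastforce simp: q_fact_def)

lemma q_fact_Suc: "q_fact q (Suc n) = q_fact q n * (1 - q ^ Suc n)"
  by (simp add: q_fact_def)

lemma powi_add: "q powi (x + y) = q powi x * q powi y"
  using q_nonzero by (simp add: power_int_add)

text \<open>
  With the value 0 for \<open>z < 0\<close>, the recurrence \<open>inv_q_fact_rec\<close> and the product formula for
  \<open>q\<close>-binomials hold for all integers without side conditions.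
\<close>

definition inv_q_fact :: "int \<Rightarrow> 'a" where
  "inv_q_fact z = (if z < 0 then 0 else 1 / q_fact q (nat z))"

lemma inv_q_fact_neg [simp]: "z < 0 \<Longrightarrow> inv_q_fact z = 0"
  by (simp add: inv_q_fact_def)

lemma inv_q_fact_int [simp]: "inv_q_fact (int n) = 1 / q_fact q n"
  by (simp add: inv_q_fact_def)

lemma inv_q_fact_rec: "inv_q_fact (z - 1) = (1 - q powi z) * inv_q_fact z"
proof (cases "z \<le> 0")
  case True
  then show ?thesis by (cases "z = 0") auto
next
  case False
  then obtain n where z: "z = int (Suc n)"
    by (metis gr0_conv_Suc not_le zero_less_imp_eq_int)
  have "1 - q ^ Suc n \<noteq> 0"
    using q_power_neq_1[of "Suc n"] by auto
  moreover have "inv_q_fact (z - 1) = 1 / q_fact q n"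
    using z inv_q_fact_int[of n] by simp
  moreover have "inv_q_fact z = 1 / (q_fact q n * (1 - q ^ Suc n))"
    unfolding z inv_q_fact_int q_fact_Suc ..
  moreover have "q powi z = q ^ Suc n"
    unfolding z by (rule power_int_of_nat)
  ultimately show ?thesis
    using q_fact_nonzero[of n] by (simp del: power_Suc)
qed

lemma q_binomial_eq:
  "q_binomial q n k = q_fact q n * inv_q_fact k * inv_q_fact (int n - k)"
proof (cases "0 \<le> k \<and> k \<le> int n")
  case True
  then have "nat (int n - k) = n - nat k" by auto
  with True show ?thesis by (simp add: q_binomial_def inv_q_fact_def)
qed (auto simp: q_binomial_def)

lemma q_binomial_0: "q_binomial q 0 k = (if k = 0 then 1 else 0)"
  by (auto simp: q_binomial_def q_fact_def)

text \<open>With \<open>X = q powi k\<close> and \<open>Y = q powi (int n + 1 - k)\<close>, the new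
  factor is \<open>1 - X * Y\<close>. The two rules are its splittings
  \<open>(1 - X) + X * (1 - Y)\<close> and \<open>Y * (1 - X) + (1 - Y)\<close>.\<close>

lemma q_binomial_Suc:
  shows "q_binomial q (Suc n) k = q_binomial q n (k - 1) + q powi k * q_binomial q n k"
    and "q_binomial q (Suc n) k =
      q powi (int n + 1 - k) * q_binomial q n (k - 1) + q_binomial q n k"
proof -
  let ?R = inv_q_fact
  have 1: "?R (k - 1) = (1 - q powi k) * ?R k"
    by (rule inv_q_fact_rec)
  have 2: "?R (int n - k) = (1 - q powi (int n + 1 - k)) * ?R (int n + 1 - k)"
    using inv_q_fact_rec[of "int n + 1 - k"] by (simp add: algebra_simps)
  have 3: "int n - (k - 1) = int n + 1 - k" "int (Suc n) - k = int n + 1 - k"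
    by auto
  have 4: "q * q ^ n = q powi k * q powi (int n + 1 - k)"
    unfolding powi_add[symmetric] by (simp add: power_int_def nat_add_distrib)
  show "q_binomial q (Suc n) k = q_binomial q n (k - 1) + q powi k * q_binomial q n k"
    unfolding q_binomial_eq 3 1 2 q_fact_Suc power_Suc 4 by algebra
  show "q_binomial q (Suc n) k =
      q powi (int n + 1 - k) * q_binomial q n (k - 1) + q_binomial q n k"
    unfolding q_binomial_eq 3 1 2 q_fact_Suc power_Suc 4 by algebra
qed

section \<open>The two forms of the q-Vandermonde identity\<close>

text \<open>Induction on \<open>b\<close>: the second Pascal rule is applied to the left side and,
  termwise, to the factor with upper index \<open>Suc b\<close>.\<close>

lemma q_Vandermonde:
  "q_binomial q (a + b) c =
    (\<Sum>i\<in>{0..int a}. q powi ((int a - i) * (c - i)) * q_binomial q a i * q_binomial q b (c - i))"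
proof (induction b arbitrary: c)
  case 0
  have "(\<Sum>i\<in>{0..int a}. q powi ((int a - i) * (c - i)) * q_binomial q a i * q_binomial q 0 (c - i))
      = (\<Sum>i\<in>{0..int a}. if c = i then q_binomial q a i else 0)"
    by (rule sum.cong) (auto simp: q_binomial_0)
  also have "\<dots> = q_binomial q a c"
    by (auto simp: q_binomial_def)
  finally show ?case by simp
next
  case (Suc b)
  have "q_binomial q (a + Suc b) c =
      q powi (int (a + b) + 1 - c) * q_binomial q (a + b) (c - 1) + q_binomial q (a + b) c"
    using q_binomial_Suc(2)[of "a + b" c] by simp
  also have "\<dots> = (\<Sum>i\<in>{0..int a}. q powi (int (a + b) + 1 - c) *
        (q powi ((int a - i) * (c - 1 - i)) * q_binomial q a i * q_binomial q b (c - 1 - i))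
      + q powi ((int a - i) * (c - i)) * q_binomial q a i * q_binomial q b (c - i))"
    unfolding Suc.IH sum_distrib_left sum.distrib ..
  also have "\<dots> = (\<Sum>i\<in>{0..int a}.
      q powi ((int a - i) * (c - i)) * q_binomial q a i * q_binomial q (Suc b) (c - i))"
  proof (rule sum.cong)
    fix i
    have "q powi (int (a + b) + 1 - c) * q powi ((int a - i) * (c - 1 - i))
        = q powi ((int a - i) * (c - i)) * q powi (int b + 1 - (c - i))"
      unfolding powi_add[symmetric] by (simp add: algebra_simps)
    moreover have "x * (y * A * B) + z * A * C = z * A * (u * B + C)"
      if "x * y = z * u" for x y z u A B C :: 'a
      using that by algebra
    moreover have "c - i - 1 = c - 1 - i" by simp
    ultimately show "q powi (int (a + b) + 1 - c) *
        (q powi ((int a - i) * (c - 1 - i)) * q_binomial q a i * q_binomial q b (c - 1 - i))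
      + q powi ((int a - i) * (c - i)) * q_binomial q a i * q_binomial q b (c - i)
      = q powi ((int a - i) * (c - i)) * q_binomial q a i * q_binomial q (Suc b) (c - i)"
      unfolding q_binomial_Suc(2)[of b "c - i"]
      by metis
  qed simp
  finally show ?case .
qed

text \<open>The first form with \<open>a\<close> and \<open>b\<close> exchanged and \<open>i\<close>
  replaced by \<open>c - i\<close>. The sums are first cut to the indices where both q-binomials can
  be nonzero, because only these ranges correspond under the reflection.\<close>

lemma q_Vandermonde':
  "q_binomial q (a + b) c =
    (\<Sum>i\<in>{0..int a}. q powi (i * (int b - c + i)) * q_binomial q a i * q_binomial q b (c - i))"
proof -
  have "(\<Sum>i\<in>{0..int b}. q powi ((int b - i) * (c - i)) * q_binomial q b i * q_binomial q a (c - i))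
      = (\<Sum>i\<in>{0..int b} \<inter> {c - int a..c}.
          q powi ((int b - i) * (c - i)) * q_binomial q b i * q_binomial q a (c - i))"
    by (rule sum.mono_neutral_right) (auto simp: q_binomial_def)
  also have "\<dots> = (\<Sum>i\<in>{0..int a} \<inter> {c - int b..c}.
      q powi (i * (int b - c + i)) * q_binomial q a i * q_binomial q b (c - i))"
    by (rule sum.reindex_bij_witness[of _ "\<lambda>i. c - i" "\<lambda>i. c - i"])
       (auto simp: algebra_simps)
  also have "\<dots> = (\<Sum>i\<in>{0..int a}.
      q powi (i * (int b - c + i)) * q_binomial q a i * q_binomial q b (c - i))"
    by (rule sum.mono_neutral_left) (auto simp: q_binomial_def)
  finally show ?thesis
    using q_Vandermonde[of b a c] by (simp add: add.commute)
qed

section \<open>Expanding products of kernels\<close>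

definition bailey_kernel :: "int \<Rightarrow> nat \<Rightarrow> 'a" where
  "bailey_kernel k n = inv_q_fact (int n - k) * inv_q_fact (int n + k)"

lemma bailey_kernel_eq_0: "\<bar>k\<bar> > int n \<Longrightarrow> bailey_kernel k n = 0"
  by (cases "k \<ge> 0") (auto simp: bailey_kernel_def)

lemma q_binomial_central:
  "q_binomial q (2 * n) (int n + k) = q_fact q (2 * n) * bailey_kernel k n"
  by (simp add: q_binomial_eq bailey_kernel_def)

text \<open>The weight \<open>w\<close> is left open so that both Vandermonde forms fit. Multiplying
  the identity by the reciprocals of the q-factorials of \<open>a - k\<close> and
  \<open>b + k\<close> completes the left side to two kernels and cancels these q-factorials on the
  right; the index is \<open>s = k + i\<close>.\<close>

lemma bailey_kernel_mult_aux:
  assumes k: "\<bar>k\<bar> \<le> int a" "\<bar>k\<bar> \<le> int b"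
    and V: "q_binomial q (a + b) (int b - k) =
      (\<Sum>i\<in>{0..int a - k}. w (k + i) * q_binomial q (nat (int a - k)) i
        * q_binomial q (nat (int b + k)) (int b - k - i))"
  shows "q_fact q (a + b) * (bailey_kernel k a * bailey_kernel k b) =
    (\<Sum>s\<le>a. w (int s) * inv_q_fact (int a - int s) * inv_q_fact (int b - int s) * bailey_kernel k s)"
proof -
  let ?R = inv_q_fact
  let ?f = "\<lambda>s. w s * ?R (int a - s) * ?R (int b - s) * (?R (s - k) * ?R (s + k))"
  have "0 \<le> int a - k" "0 \<le> int b + k" using k by auto
  then obtain u v where u: "int a - k = int u" and v: "int b + k = int v"
    by (meson nonneg_int_cases)
  have "q_fact q (a + b) * (?R (int b - k) * ?R (int a + k)) = q_binomial q (a + b) (int b - k)"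
    by (simp add: q_binomial_eq)
  also have "\<dots> = (\<Sum>i\<in>{0..int a - k}. q_fact q u * q_fact q v * ?f (k + i))"
    unfolding V u v nat_int
  proof (rule sum.cong)
    fix i
    have e: "int u - i = int a - (k + i)" "int b - k - i = int b - (k + i)"
      "int v - (int b - (k + i)) = k + i + k" "i = k + i - k"
      using u v by auto
    show "w (k + i) * q_binomial q u i * q_binomial q v (int b - k - i)
        = q_fact q u * q_fact q v * ?f (k + i)"
      unfolding q_binomial_eq e(1-3) using e(4) by (simp only: ac_simps)
  qed simp
  also have "\<dots> = q_fact q u * q_fact q v * (\<Sum>s\<in>{k..int a}. ?f s)"
    unfolding sum_distrib_left
    by (rule sum.reindex_bij_witness[of _ "\<lambda>s. s - k" "\<lambda>i. k + i"]) auto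
  \<comment> \<open>Terms with \<open>s < \<bar>k\<bar>\<close> vanish, as \<open>s - k\<close> or
    \<open>s + k\<close> is negative. The detour through \<open>\<bar>k\<bar>\<close> treats both
    signs of \<open>k\<close> at once.\<close>
  also have "(\<Sum>s\<in>{k..int a}. ?f s) = (\<Sum>s\<in>{\<bar>k\<bar>..int a}. ?f s)"
    by (rule sum.mono_neutral_right) (auto simp: abs_if split: if_splits)
  also have "\<dots> = (\<Sum>s\<in>{0..int a}. ?f s)"
    by (rule sum.mono_neutral_left) (auto simp: abs_if split: if_splits)
  also have "\<dots> = (\<Sum>s\<le>a. ?f (int s))"
    by (rule sum.reindex_bij_witness[of _ int nat]) auto
  finally have main: "q_fact q (a + b) * (?R (int b - k) * ?R (int a + k)) =
    q_fact q u * q_fact q v * (\<Sum>s\<le>a. ?f (int s))" .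
  have "q_fact q (a + b) * (bailey_kernel k a * bailey_kernel k b) =
      q_fact q (a + b) * (?R (int b - k) * ?R (int a + k)) * (?R (int u) * ?R (int v))"
    by (simp add: bailey_kernel_def u[symmetric] v[symmetric] del: inv_q_fact_int)
  also have "\<dots> = (\<Sum>s\<le>a. ?f (int s))"
    unfolding main using q_fact_nonzero by simp
  finally show ?thesis by (simp add: bailey_kernel_def)
qed

lemma bailey_kernel_mult:
  shows "q_fact q (a + b) * (bailey_kernel k a * bailey_kernel k b) =
      (\<Sum>s\<le>a. q powi (int s ^ 2 - k ^ 2) * inv_q_fact (int a - int s) * inv_q_fact (int b - int s)
        * bailey_kernel k s)" (is ?A)
    and "q_fact q (a + b) * (bailey_kernel k a * bailey_kernel k b) =
      (\<Sum>s\<le>a. q powi ((int a - int s) * (int b - int s)) * inv_q_fact (int a - int s)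
        * inv_q_fact (int b - int s) * bailey_kernel k s)" (is ?B)
proof -
  have "?A \<and> ?B"
  proof (cases "\<bar>k\<bar> \<le> int a \<and> \<bar>k\<bar> \<le> int b")
    case True
    define u v where uv: "u = nat (int a - k)" "v = nat (int b + k)"
    have sum: "u + v = a + b" "int u = int a - k" "int v = int b + k"
      using True by (auto simp: uv)
    have 1: "i * (int v - (int b - k) + i) = (k + i) ^ 2 - k ^ 2" for i
      using sum by (simp add: algebra_simps power2_eq_square)
    have 2: "(int u - i) * (int b - k - i) = (int a - (k + i)) * (int b - (k + i))" for i
    proof -
      have "int u - i = int a - (k + i)" "int b - k - i = int b - (k + i)" using sum by auto
      then show ?thesis by (simp only:)
    qed
    have k: "\<bar>k\<bar> \<le> int a" "\<bar>k\<bar> \<le> int b" using True by auto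
    note V = q_Vandermonde'[of u v "int b - k", unfolded 1, unfolded sum]
      q_Vandermonde[of u v "int b - k", unfolded 2, unfolded sum]
    have ?A
      by (rule bailey_kernel_mult_aux[OF k, of "\<lambda>s. q powi (s ^ 2 - k ^ 2)",
            folded uv, OF V(1)])
    moreover have ?B
      by (rule bailey_kernel_mult_aux[OF k, of "\<lambda>s. q powi ((int a - s) * (int b - s))",
            folded uv, OF V(2)])
    ultimately show ?thesis ..
  next
    case False
    then have 0: "bailey_kernel k a * bailey_kernel k b = 0"
      by (auto simp: bailey_kernel_eq_0)
    \<comment> \<open>If \<open>\<bar>k\<bar> \<le> s \<le> a\<close>, then
      \<open>\<bar>k\<bar>\<close> must exceed \<open>b\<close>, so \<open>b - s\<close> is
      negative.\<close>
    have "inv_q_fact (int b - int s) * bailey_kernel k s = 0" if "s \<le> a" for s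
      using False that by (cases "\<bar>k\<bar> > int s") (auto simp: bailey_kernel_eq_0)
    then have "(\<Sum>s\<le>a. f s * inv_q_fact (int b - int s) * bailey_kernel k s) = 0" for f
      by (intro sum.neutral) (simp add: mult.assoc)
    then show ?thesis
      unfolding 0 by simp
  qed
  then show ?A ?B by auto
qed

section \<open>Alternating sums and their recursion\<close>

text \<open>The value 0 taken after the last entry is the convention that
  \<open>n (m + 1) = 0\<close>.\<close>

fun chain_q_fact :: "nat list \<Rightarrow> 'a" where
  "chain_q_fact [] = 1"
| "chain_q_fact (x # xs) = q_fact q (x + (case xs of [] \<Rightarrow> 0 | y # _ \<Rightarrow> y)) * chain_q_fact xs"

text \<open>The expression of the theorem for the sequence \<open>a # xs\<close>, with the
  q-factorials of \<open>2 * n i\<close> cancelled. The head is a separate argument because the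
  recursion replaces it by all \<open>s \<le> a\<close>, including 0.\<close>

definition alt_sum :: "nat \<Rightarrow> nat \<Rightarrow> nat list \<Rightarrow> 'a" where
  "alt_sum j a xs = q_fact q a * chain_q_fact (a # xs) *
    (\<Sum>k\<in>{- int a..int a}. (-1) powi k * q powi (int j * k\<^sup>2 + k * (k - 1) div 2)
      * (\<Prod>x\<leftarrow>a # xs. bailey_kernel k x))"

text \<open>Gives the sums for all \<open>s \<le> a\<close> a common range of \<open>k\<close>, so
  that the summations can be interchanged.\<close>

lemma alt_sum_extend:
  assumes "a \<le> b"
  shows "alt_sum j a xs = q_fact q a * chain_q_fact (a # xs) *
    (\<Sum>k\<in>{- int b..int b}. (-1) powi k * q powi (int j * k\<^sup>2 + k * (k - 1) div 2)
      * (\<Prod>x\<leftarrow>a # xs. bailey_kernel k x))"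
  unfolding alt_sum_def using assms
  by (intro arg_cong[where f = "(*) _"] sum.mono_neutral_left)
     (auto simp: bailey_kernel_eq_0)

text \<open>After expanding the first two kernels and swapping sums, the prefactors regroup into two
  q-binomials times those of the shorter sum with head \<open>s\<close>.\<close>

lemma alt_sum_Cons_aux:
  fixes w :: "nat \<Rightarrow> 'a"
  assumes kernel: "\<And>k. q powi (int j * k\<^sup>2) * (q_fact q (a + b) * (bailey_kernel k a * bailey_kernel k b)) =
      (\<Sum>s\<le>a. w s * q powi (int j' * k\<^sup>2) * inv_q_fact (int a - int s) * inv_q_fact (int b - int s)
        * bailey_kernel k s)"
    and h: "h = (case xs of [] \<Rightarrow> 0 | y # _ \<Rightarrow> y)"
  shows "alt_sum j a (b # xs) = (\<Sum>s\<le>a. w s * q_binomial q a (int s)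
    * q_binomial q (b + h) (int b - int s) * alt_sum j' s xs)"
proof -
  let ?R = inv_q_fact
  define g where "g k = (-1) powi k * q powi (k * (k - 1) div 2)
      * (\<Prod>x\<leftarrow>xs. bailey_kernel k x)" for k
  have "alt_sum j a (b # xs) = q_fact q a * chain_q_fact (b # xs) *
      (\<Sum>k\<in>{- int a..int a}. g k * (q powi (int j * k\<^sup>2) *
        (q_fact q (a + b) * (bailey_kernel k a * bailey_kernel k b))))"
    by (simp add: alt_sum_def g_def powi_add sum_distrib_left ac_simps)
  also have "\<dots> = (\<Sum>k\<in>{- int a..int a}. \<Sum>s\<le>a. q_fact q a * chain_q_fact (b # xs) * (g k *
      (w s * q powi (int j' * k\<^sup>2) * ?R (int a - int s) * ?R (int b - int s) * bailey_kernel k s)))"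
    unfolding kernel sum_distrib_left ..
  also have "\<dots> = (\<Sum>s\<le>a. \<Sum>k\<in>{- int a..int a}. q_fact q a * chain_q_fact (b # xs) * (g k *
      (w s * q powi (int j' * k\<^sup>2) * ?R (int a - int s) * ?R (int b - int s) * bailey_kernel k s)))"
    by (rule sum.swap)
  also have "\<dots> = (\<Sum>s\<le>a. w s * q_binomial q a (int s)
    * q_binomial q (b + h) (int b - int s) * alt_sum j' s xs)"
  proof (rule sum.cong)
    fix s assume "s \<in> {..a}"
    then have "s \<le> a" by simp
    have h': "int (b + h) - (int b - int s) = int (s + h)" by simp
    have "q_binomial q a (int s) * q_binomial q (b + h) (int b - int s)
        * (q_fact q s * chain_q_fact (s # xs)) =
      q_fact q a * chain_q_fact (b # xs) * (?R (int a - int s) * ?R (int b - int s))"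
      unfolding q_binomial_eq h' using q_fact_nonzero
      by (simp add: h[symmetric] field_simps del: of_nat_add)
    then have "w s * q_binomial q a (int s) * q_binomial q (b + h) (int b - int s) * alt_sum j' s xs
      = w s * (q_fact q a * chain_q_fact (b # xs) * (?R (int a - int s) * ?R (int b - int s))) *
        (\<Sum>k\<in>{- int a..int a}. (-1) powi k * q powi (int j' * k\<^sup>2 + k * (k - 1) div 2)
          * (\<Prod>x\<leftarrow>s # xs. bailey_kernel k x))"
      unfolding alt_sum_extend[OF \<open>s \<le> a\<close>] by (metis (no_types, lifting) mult.assoc)
    then show "(\<Sum>k\<in>{- int a..int a}. q_fact q a * chain_q_fact (b # xs) * (g k *
      (w s * q powi (int j' * k\<^sup>2) * ?R (int a - int s) * ?R (int b - int s) * bailey_kernel k s)))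
      = w s * q_binomial q a (int s) * q_binomial q (b + h) (int b - int s) * alt_sum j' s xs"
      by (simp add: g_def powi_add sum_distrib_left ac_simps)
  qed simp
  finally show ?thesis .
qed

text \<open>The weight \<open>q powi (int s ^ 2 - k ^ 2)\<close> absorbs one copy of
  \<open>k\<^sup>2\<close>, which lowers \<open>Suc j\<close> to \<open>j\<close>.\<close>

lemma alt_sum_Suc_Cons:
  "alt_sum (Suc j) a (b # xs) = (\<Sum>s\<le>a. q ^ s\<^sup>2 * q_binomial q a (int s)
    * q_binomial q (b + (case xs of [] \<Rightarrow> 0 | y # _ \<Rightarrow> y)) (int b - int s) * alt_sum j s xs)"
proof (rule alt_sum_Cons_aux[OF _ refl])
  fix k
  have "q powi (int (Suc j) * k\<^sup>2) * q powi (int s ^ 2 - k ^ 2) = q ^ s\<^sup>2 * q powi (int j * k\<^sup>2)" for s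
  proof -
    have "q ^ s\<^sup>2 = q powi (int s ^ 2)"
      by (metis of_nat_power power_int_of_nat)
    then show ?thesis
      unfolding powi_add[symmetric] by (simp add: powi_add[symmetric] algebra_simps)
  qed
  then show "q powi (int (Suc j) * k\<^sup>2) * (q_fact q (a + b) * (bailey_kernel k a * bailey_kernel k b)) =
      (\<Sum>s\<le>a. q ^ s\<^sup>2 * q powi (int j * k\<^sup>2) * inv_q_fact (int a - int s) * inv_q_fact (int b - int s)
        * bailey_kernel k s)"
    unfolding bailey_kernel_mult(1) sum_distrib_left
    by (simp add: mult.assoc[symmetric] del: of_nat_Suc)
qed

text \<open>The weight of the second expansion is free of \<open>k\<close>, so \<open>j\<close> is
  unchanged.\<close>

lemma alt_sum_Cons:
  "alt_sum j a (b # xs) = (\<Sum>s\<le>a. q powi ((int a - int s) * (int b - int s)) * q_binomial q a (int s)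
    * q_binomial q (b + (case xs of [] \<Rightarrow> 0 | y # _ \<Rightarrow> y)) (int b - int s) * alt_sum j s xs)"
  by (rule alt_sum_Cons_aux[OF _ refl])
     (subst bailey_kernel_mult(2), simp add: sum_distrib_left ac_simps)

section \<open>The base case: a telescoping sum\<close>

text \<open>
  The terms for \<open>k\<close> and \<open>-k\<close> have to be added first: the sum over \<open>0 \<le> k \<le> K\<close> alone
  does not telescope.
\<close>

lemma bailey_kernel_alt_sum_partial:
  assumes "a > 0"
  shows "(1 - q ^ a) * (\<Sum>k\<in>{- int K..int K}. (-1) powi k * q powi (k * (k - 1) div 2) * bailey_kernel k a)
    = (-1) ^ K * q powi (int K * (int K + 1) div 2) * inv_q_fact (int a - int K - 1)
      * inv_q_fact (int a + int K)"
proof (induction K)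
  case 0
  show ?case
    using inv_q_fact_rec[of "int a"] by (simp add: bailey_kernel_def)
next
  case (Suc K)
  let ?t = "\<lambda>k. (-1) powi k * q powi (k * (k - 1) div 2) * bailey_kernel k a"
  define c where "c = int (Suc K)"
  define e where "e = int K * (int K + 1) div 2"
  have "{- c..c} = insert c (insert (- c) {- int K..int K})"
    by (auto simp: c_def)
  then have split: "(\<Sum>k\<in>{- c..c}. ?t k) = ?t c + (?t (- c) + (\<Sum>k\<in>{- int K..int K}. ?t k))"
    by (simp add: c_def)
  have e1: "c * (c - 1) div 2 = e"
    by (simp add: c_def e_def algebra_simps)
  have eq: "- c * (- c - 1) = int K * (int K + 1) + c * 2" "c * (c + 1) = int K * (int K + 1) + c * 2"
    by (auto simp: c_def algebra_simps)
  have e2: "- c * (- c - 1) div 2 = e + c" "c * (c + 1) div 2 = e + c"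
    unfolding eq e_def by auto
  have sign: "(-1) powi c = - ((-1) ^ K :: 'a)" "(-1) powi (- c) = - ((-1) ^ K :: 'a)"
    by (auto simp: c_def power_int_minus power_int_def nat_add_distrib inverse_eq_divide
        minus_one_power_iff)
  have r1: "inv_q_fact (int a - c - 1) = (1 - q powi (int a - c)) * inv_q_fact (int a - c)"
    by (rule inv_q_fact_rec)
  have r2: "inv_q_fact (int a + int K) = (1 - q powi (int a + c)) * inv_q_fact (int a + c)"
    using inv_q_fact_rec[of "int a + c"] by (simp add: c_def algebra_simps)
  have r3: "int a - int K - 1 = int a - c" by (simp add: c_def)
  have p: "q ^ a = q powi (int a - c) * q powi c" "q powi (int a + c) = q ^ a * q powi c"
    unfolding powi_add by (simp_all add: powi_add[symmetric])
  have "(1 - q ^ a) * (\<Sum>k\<in>{- c..c}. ?t k) = (1 - q ^ a) * (?t c + ?t (- c)) +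
      (-1) ^ K * q powi e * inv_q_fact (int a - c) * inv_q_fact (int a + int K)"
    unfolding split distrib_left Suc.IH[unfolded r3 e_def[symmetric]] add.assoc ..
  also have "\<dots> = - ((-1) ^ K) * q powi (e + c) * inv_q_fact (int a - c - 1) * inv_q_fact (int a + c)"
  proof -
    \<comment> \<open>Here \<open>X = q powi (int a - c)\<close>, \<open>Y = q powi c\<close>,
      \<open>P = q powi e\<close>, \<open>S\<close> is the sign \<open>(-1) ^ K\<close>, and
      \<open>A\<close>, \<open>B\<close> are the two factors of the kernel at
      \<open>c\<close>.\<close>
    have "(1 - X * Y) * (- S * P * (A * B) + - S * (P * Y) * (B * A)) + S * P * A * ((1 - X * Y * Y) * B)
        = - S * (P * Y) * ((1 - X) * A) * B" for S P X Y A B :: 'a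
      by (simp add: algebra_simps)
    then show ?thesis
      unfolding e1 e2 sign r1 r2 p powi_add[of e c] bailey_kernel_def diff_minus_eq_add
        add_uminus_conv_diff .
  qed
  finally show ?case
    unfolding c_def[symmetric] e2 by simp
qed

text \<open>For \<open>a > 0\<close>, the partial sum formula at \<open>K = a\<close> contains
  \<open>inv_q_fact (- 1)\<close>, which is 0.\<close>

lemma alt_sum_0_Nil: "alt_sum 0 a [] = (if a = 0 then 1 else 0)"
proof (cases "a = 0")
  case True
  then show ?thesis by (simp add: alt_sum_def bailey_kernel_def q_fact_def inv_q_fact_def)
next
  case False
  then have "q ^ a \<noteq> 1" by (simp add: q_power_neq_1)
  then have "(\<Sum>k\<in>{- int a..int a}. (-1) powi k * q powi (k * (k - 1) div 2) * bailey_kernel k a) = 0"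
    using bailey_kernel_alt_sum_partial[of a a] False by simp
  then show ?thesis using False by (simp add: alt_sum_def)
qed

section \<open>Nonnegativity via a set closed under addition and multiplication\<close>

context
  fixes N :: "'a set"
  assumes N_0: "0 \<in> N" and N_1: "1 \<in> N" and N_q: "q \<in> N"
    and N_add: "\<And>x y. x \<in> N \<Longrightarrow> y \<in> N \<Longrightarrow> x + y \<in> N"
    and N_mult: "\<And>x y. x \<in> N \<Longrightarrow> y \<in> N \<Longrightarrow> x * y \<in> N"
begin

lemma N_power: "q ^ i \<in> N"
  by (induction i) (auto intro: N_1 N_q N_mult)

lemma N_powi: "e \<ge> 0 \<Longrightarrow> q powi e \<in> N"
  by (simp add: power_int_def N_power)

lemma N_sum: "(\<And>i. i \<in> I \<Longrightarrow> f i \<in> N) \<Longrightarrow> sum f I \<in> N"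
  by (induction I rule: infinite_finite_induct) (auto intro: N_0 N_add)

lemma q_binomial_in_N: "q_binomial q n k \<in> N"
proof (induction n arbitrary: k)
  case 0
  show ?case by (auto simp: q_binomial_0 N_0 N_1)
next
  case (Suc n)
  show ?case
  proof (cases "k \<ge> 0")
    case True
    then show ?thesis by (auto simp: q_binomial_Suc(1) intro!: N_add N_mult N_powi Suc.IH)
  next
    case False
    then show ?thesis by (simp add: q_binomial_def N_0)
  qed
qed

text \<open>As long as \<open>j > 0\<close>, both \<open>j\<close> and the length drop; afterwards
  only the length does. The bound on \<open>j\<close> ensures that the empty list is met with
  \<open>j = 0\<close>.\<close>

lemma alt_sum_in_N: "j \<le> length xs \<Longrightarrow> alt_sum j a xs \<in> N"
proof (induction xs arbitrary: a j)
  case Nil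
  then show ?case by (simp add: alt_sum_0_Nil N_0 N_1)
next
  case (Cons b xs)
  show ?case
  proof (cases j)
    case 0
    have "q powi ((int a - int s) * (int b - int s)) * q_binomial q a (int s)
      * q_binomial q (b + h) (int b - int s) * alt_sum j s xs \<in> N" if "s \<le> a" for s h
    \<comment> \<open>For \<open>s > b\<close> the exponent of \<open>q\<close> may be negative, but
      the second q-binomial is then 0.\<close>
    proof (cases "s \<le> b")
      case True
      then show ?thesis using that 0
        by (intro N_mult N_powi q_binomial_in_N Cons.IH) auto
    next
      case False
      then show ?thesis by (simp add: q_binomial_def N_0)
    qed
    then show ?thesis unfolding alt_sum_Cons by (intro N_sum) simp
  next
    case (Suc i)
    then show ?thesis using Cons
      by (auto simp: alt_sum_Suc_Cons intro!: N_sum N_mult N_power q_binomial_in_N)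
  qed
qed

end

section \<open>Return to indexed products and the fraction field\<close>

lemma chain_q_fact_map_upt:
  assumes "l \<le> m" and "n (Suc m) = 0"
  shows "chain_q_fact (map n [l..<Suc m]) = (\<Prod>i=l..m. q_fact q (n i + n (i + 1)))"
  using assms(1)
proof (induction l rule: inc_induct)
  case base
  then show ?case using assms(2) by simp
next
  case (step l)
  \<comment> \<open>Two entries are exposed because \<open>chain_q_fact\<close> looks one entry
    ahead.\<close>
  have "[l..<Suc m] = l # Suc l # [Suc (Suc l)..<Suc m]" "[Suc l..<Suc m] = Suc l # [Suc (Suc l)..<Suc m]"
    using step.hyps by (simp_all add: upt_conv_Cons del: upt_Suc)
  then have "chain_q_fact (map n [l..<Suc m]) =
      q_fact q (n l + n (Suc l)) * chain_q_fact (map n [Suc l..<Suc m])"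
    by simp
  also have "\<dots> = (\<Prod>i=l..m. q_fact q (n i + n (i + 1)))"
    unfolding step.IH using step.hyps by (simp add: prod.atLeast_Suc_atMost[of l m])
  finally show ?case .
qed

lemma alt_sum_map_upt:
  assumes "m > 0" and "n (m + 1) = 0"
  shows "q_fact q (n 1)
      * (\<Prod>i=1..m. q_fact q (n i + n (i + 1)) / q_fact q (2 * n i))
      * (\<Sum>k::int\<in>{- int (n 1)..int (n 1)}.
           (-1) powi k * q powi (int j * k\<^sup>2 + k * (k - 1) div 2)
             * (\<Prod>i=1..m. q_binomial q (2 * n i) (int (n i) + k)))
    = alt_sum j (n 1) (map n [2..<Suc m])"
proof -
  have upt: "[1..<Suc m] = 1 # [2..<Suc m]"
    using assms(1) by (simp add: upt_conv_Cons numeral_2_eq_2 del: upt_Suc)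
  have kernel: "(\<Prod>x\<leftarrow>map n [1..<Suc m]. bailey_kernel k x) = (\<Prod>i=1..m. bailey_kernel k (n i))" for k
    by (simp add: prod.distinct_set_conv_list[symmetric] comp_def atLeastLessThanSuc_atLeastAtMost del: upt_Suc)
  have "(\<Prod>i=1..m. q_fact q (2 * n i)) \<noteq> 0"
    by (simp add: q_fact_nonzero)
  moreover have "chain_q_fact (map n [1..<Suc m]) = (\<Prod>i=1..m. q_fact q (n i + n (i + 1)))"
    using assms by (intro chain_q_fact_map_upt) auto
  moreover have "alt_sum j (n 1) (map n [2..<Suc m]) = q_fact q (n 1) * chain_q_fact (map n [1..<Suc m]) *
    (\<Sum>k\<in>{- int (n 1)..int (n 1)}. (-1) powi k * q powi (int j * k\<^sup>2 + k * (k - 1) div 2)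
      * (\<Prod>i=1..m. bailey_kernel k (n i)))"
    unfolding alt_sum_def kernel[symmetric] unfolding upt list.map ..
  ultimately show ?thesis
    unfolding q_binomial_central prod.distrib prod_dividef
    by (simp add: sum_distrib_left ac_simps del: upt_Suc)
qed

end

lemma generic_q_qvar: "generic_q qvar"
proof
  show "qvar \<noteq> 0" by (simp add: qvar_def)
  fix i :: nat assume "i > 0"
  have "qvar ^ i = to_fract ([:0, 1:] ^ i)"
    unfolding qvar_def by (induction i) (simp_all del: mult_pCons_left)
  moreover have "[:0, 1:] ^ i \<noteq> (1 :: int poly)"
  proof
    assume "[:0, 1:] ^ i = (1 :: int poly)"
    \<comment> \<open>Evaluation at 0 separates a positive power of the indeterminate from
      1.\<close>
    then have "poly ([:0, 1:] ^ i) 0 = (1 :: int)" by simp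
    with \<open>i > 0\<close> show False by (simp add: zero_power)
  qed
  ultimately show "qvar ^ i \<noteq> 1"
    by (metis to_fract_1 to_fract_eq_iff)
qed

theorem theorem4p7:
  fixes m j :: nat and n :: "nat \<Rightarrow> nat"
  assumes "\<And>i. i \<in> {1..m} \<Longrightarrow> n i > 0"
    and "n (m + 1) = 0"
    and "j < m"
  shows "\<exists>p :: int poly. (\<forall>i. coeff p i \<ge> 0) \<and>
    q_fact qvar (n 1)
      * (\<Prod>i=1..m. q_fact qvar (n i + n (i + 1)) / q_fact qvar (2 * n i))
      * (\<Sum>k::int\<in>{- int (n 1)..int (n 1)}.
           (-1) powi k * qvar powi (int j * k\<^sup>2 + k * (k - 1) div 2)
             * (\<Prod>i=1..m. q_binomial qvar (2 * n i) (int (n i) + k)))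
      = to_fract p"
proof -
  interpret generic_q qvar by (rule generic_q_qvar)
  define N where "N = to_fract ` {p :: int poly. \<forall>i. coeff p i \<ge> 0}"
  have "alt_sum j (n 1) (map n [2..<Suc m]) \<in> N"
  proof (rule alt_sum_in_N)
    show "0 \<in> N" unfolding N_def by (rule image_eqI[of _ _ 0]) auto
    show "1 \<in> N" unfolding N_def by (rule image_eqI[of _ _ 1]) auto
    show "qvar \<in> N" unfolding N_def qvar_def
      by (rule imageI) (auto simp: coeff_pCons split: nat.splits)
    show "x + y \<in> N" if "x \<in> N" "y \<in> N" for x y
    proof -
      from that obtain p r where "x = to_fract p" "y = to_fract r"
        "\<forall>i. coeff p i \<ge> 0" "\<forall>i. coeff r i \<ge> 0" by (auto simp: N_def)
      then show ?thesis unfolding N_def by (intro image_eqI[of _ _ "p + r"]) auto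
    qed
    show "x * y \<in> N" if "x \<in> N" "y \<in> N" for x y
    proof -
      from that obtain p r where "x = to_fract p" "y = to_fract r"
        "\<forall>i. coeff p i \<ge> 0" "\<forall>i. coeff r i \<ge> 0" by (auto simp: N_def)
      then show ?thesis unfolding N_def
        by (intro image_eqI[of _ _ "p * r"]) (auto simp: coeff_mult intro!: sum_nonneg)
    qed
    \<comment> \<open>The list has length \<open>m - 1\<close>, so this is exactly where
      \<open>j < m\<close> enters the positivity argument.\<close>
    show "j \<le> length (map n [2..<Suc m])" using \<open>j < m\<close> by (simp del: upt_Suc)
  qed
  then show ?thesis
    using alt_sum_map_upt[of m n j] assms(2,3) by (auto simp: N_def)
qed

end
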